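(* Let $k\ge 2$. The linear operator $\Psi_k\circ\Phi_k\colon T_k\to W_{k-1}$ maps the Littlewood-Richardson cone $\mathsf{LR}_k$ surjectively onto the cone $\mathsf{BZ}_{k-1}$ of Berenstein-Zelevinsky triangles of size $k-1$, and maps $\mathsf{LR}_k(\lambda,\mu,\nu)$ bijectively onto $\mathsf{BZ}_{k-1}(\lambda,\mu,\nu)$, for any $\lambda,\mu,\nu\in\mathsf{D}_k$.
   Context: $T_k$ is the vector space of arrays $A=(a_{ij})_{0\le i\le j\le k}$ of real numbers with $a_{00}=0$. $\mathsf{D}_k$ is the set of real $k$-tuples $\lambda_1\ge\cdots\ge\lambda_k$. Littlewood-Richardson triangles: $A\in T_k$ with (P) $a_{ij}\ge0$ for $1\le i<j\le k$; (CS) $\sum_{p=0}^{i-1}a_{pj}\ge\sum_{p=0}^{i}a_{p\,j+1}$ for $1\le i\le j<k$; (LR) $\sum_{q=i}^{j}a_{iq}\ge\sum_{q=i+1}^{j+1}a_{i+1\,q}$ for $1\le i\le j<k$. $\mathsf{LR}_k$ is the cone of these; the type of $A$ is $(\lambda,\mu,\nu)$ with $\mu_j=a_{0j}$, $\lambda_j=\sum_{p=0}^{j}a_{pj}$, $\nu_i=\sum_{q=i}^{k}a_{iq}$ ($1\le i,j\le k$), and $\mathsf{LR}_k(\lambda,\mu,\nu)$ is the set of those of type $(\lambda,\mu,\nu)$. For $m\ge1$, $V_m$ is the space of real labelings $X=(x_{ij},y_{ij},z_{ij})_{1\le i\le j\le m}$, and $W_m\subseteq V_m$ is the subspace defined by,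 for all $1\le i\le j<m$: (BZ1) $y_{ij}+z_{ij}=y_{i+1\,j+1}+z_{i\,j+1}$; (BZ2) $x_{i\,j+1}+y_{ij}=x_{i+1\,j+1}+y_{i+1\,j+1}$; (BZ3) $x_{i\,j+1}+z_{i\,j+1}=x_{i+1\,j+1}+z_{ij}$. A Berenstein-Zelevinsky triangle of size $m$ is an element of $W_m$ with all entries nonnegative; $\mathsf{BZ}_m$ is the cone of these. For $\lambda,\mu,\nu\in\mathsf{D}_{m+1}$, such a triangle has type $(\lambda,\mu,\nu)$ if $x_{1j}+y_{1j}=\mu_j-\mu_{j+1}$, $x_{jj}+z_{jj}=\lambda_j-\lambda_{j+1}$ for $1\le j\le m$, and $y_{im}+z_{im}=\nu_i-\nu_{i+1}$ for $1\le i\le m$; $\mathsf{BZ}_m(\lambda,\mu,\nu)$ is the set of those of type $(\lambda,\mu,\nu)$. $\Phi_k\colon T_k\to T_k$ is $\Phi_k((a_{ij}))=(h_{ij})$ with $h_{ij}=\sum_{p=0}^{i}\sum_{q=p}^{j}a_{pq}$. $\Psi_k\colon T_k\to W_{k-1}$ is $\Psi_k((h_{ij}))=(x_{ij},y_{ij},z_{ij})_{1\le i\le j\le k-1}$ with $x_{ij}=h_{ij}+h_{i-1\,j}-h_{i-1\,j-1}-h_{i\,j+1}$, $y_{ij}=h_{i-1\,j}+h_{i\,j+1}-h_{ij}-h_{i-1\,j+1}$, $z_{ij}=h_{ij}+h_{i\,j+1}-h_{i-1\,j}-h_{i+1\,j+1}$. Equivalently, $\Psi_k\circ\Phi_k((a_{ij}))$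 has $x_{ij}=\sum_{p=0}^{i-1}a_{pj}-\sum_{p=0}^{i}a_{p\,j+1}$, $y_{ij}=a_{i\,j+1}$, $z_{ij}=\sum_{q=i}^{j}a_{iq}-\sum_{q=i+1}^{j+1}a_{i+1\,q}$.
   Formalization: The bijection is stated only for λ, μ, ν with |λ| = |μ| + |ν|; without this it fails, e.g. k = 2, λ = μ = ν = (1,1), where LR_2(λ,μ,ν) is empty but BZ_1(λ,μ,ν) contains the zero triangle. *)

theory Defs
  imports Complex_Main "HOL-Library.Function_Algebras" "HOL-Library.Product_Plus"
begin

text \<open>
  Triangular arrays of varying size live in the ambient type of functions of two natural-number
  indices and vanish outside their index range, so that an array or labeling is determined by its
  listed entries. Tuples likewise vanish outside the indices 1 to k.
\<close>

type_synonym array = "nat \<Rightarrow> nat \<Rightarrow> real"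
type_synonym labeling = "array \<times> array \<times> array"

definition array_scale :: "real \<Rightarrow> array \<Rightarrow> array" where
  "array_scale c A = (\<lambda>i j. c * A i j)"

definition labeling_scale :: "real \<Rightarrow> labeling \<Rightarrow> labeling" where
  "labeling_scale c = (\<lambda>(x, y, z). (array_scale c x, array_scale c y, array_scale c z))"

definition T_space :: "nat \<Rightarrow> array set" where
  "T_space k = {A. A 0 0 = 0 \<and> (\<forall>i j. \<not> (i \<le> j \<and> j \<le> k) \<longrightarrow> A i j = 0)}"

definition D_tuples :: "nat \<Rightarrow> (nat \<Rightarrow> real) set" where
  "D_tuples k = {l. (\<forall>j. 1 \<le> j \<and> j < k \<longrightarrow> l j \<ge> l (j + 1)) \<and> (\<forall>j. j \<notin> {1..k} \<longrightarrow> l j = 0)}"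

definition LR_cone :: "nat \<Rightarrow> array set" where
  "LR_cone k = {A \<in> T_space k.
     (\<forall>i j. 1 \<le> i \<and> i < j \<and> j \<le> k \<longrightarrow> A i j \<ge> 0) \<and>
     (\<forall>i j. 1 \<le> i \<and> i \<le> j \<and> j < k \<longrightarrow> (\<Sum>p<i. A p j) \<ge> (\<Sum>p\<le>i. A p (j + 1))) \<and>
     (\<forall>i j. 1 \<le> i \<and> i \<le> j \<and> j < k \<longrightarrow>
        (\<Sum>q=i..j. A i q) \<ge> (\<Sum>q=i+1..j+1. A (i + 1) q))}"

text \<open>
  A triangle of type (lam, mu, nu) satisfies |lam| = |mu| + |nu| (sum all entries), whereas the type
  of a labeling constrains only consecutive differences. The two notions are therefore
  comparable only under the condition |lam| = |mu| + |nu|.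
\<close>

definition LR_of_type ::
  "nat \<Rightarrow> (nat \<Rightarrow> real) \<Rightarrow> (nat \<Rightarrow> real) \<Rightarrow> (nat \<Rightarrow> real) \<Rightarrow> array set" where
  "LR_of_type k lam mu nu = {A \<in> LR_cone k.
     (\<forall>j\<in>{1..k}. mu j = A 0 j) \<and>
     (\<forall>j\<in>{1..k}. lam j = (\<Sum>p\<le>j. A p j)) \<and>
     (\<forall>i\<in>{1..k}. nu i = (\<Sum>q=i..k. A i q))}"

definition V_space :: "nat \<Rightarrow> labeling set" where
  "V_space m = {(x, y, z). \<forall>i j. \<not> (1 \<le> i \<and> i \<le> j \<and> j \<le> m) \<longrightarrow>
     x i j = 0 \<and> y i j = 0 \<and> z i j = 0}"

definition W_space :: "nat \<Rightarrow> labeling set" where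
  "W_space m = {(x, y, z) \<in> V_space m. \<forall>i j. 1 \<le> i \<and> i \<le> j \<and> j < m \<longrightarrow>
     y i j + z i j = y (i + 1) (j + 1) + z i (j + 1) \<and>
     x i (j + 1) + y i j = x (i + 1) (j + 1) + y (i + 1) (j + 1) \<and>
     x i (j + 1) + z i (j + 1) = x (i + 1) (j + 1) + z i j}"

definition BZ_cone :: "nat \<Rightarrow> labeling set" where
  "BZ_cone m = {(x, y, z) \<in> W_space m. \<forall>i j. 1 \<le> i \<and> i \<le> j \<and> j \<le> m \<longrightarrow>
     x i j \<ge> 0 \<and> y i j \<ge> 0 \<and> z i j \<ge> 0}"

definition BZ_of_type ::
  "nat \<Rightarrow> (nat \<Rightarrow> real) \<Rightarrow> (nat \<Rightarrow> real) \<Rightarrow> (nat \<Rightarrow> real) \<Rightarrow> labeling set" where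
  "BZ_of_type m lam mu nu = {(x, y, z) \<in> BZ_cone m.
     (\<forall>j\<in>{1..m}. x 1 j + y 1 j = mu j - mu (j + 1)) \<and>
     (\<forall>j\<in>{1..m}. x j j + z j j = lam j - lam (j + 1)) \<and>
     (\<forall>i\<in>{1..m}. y i m + z i m = nu i - nu (i + 1))}"

definition Phi :: "nat \<Rightarrow> array \<Rightarrow> array" where
  "Phi k A = (\<lambda>i j. if i \<le> j \<and> j \<le> k then \<Sum>p\<le>i. \<Sum>q=p..j. A p q else 0)"

definition Psi :: "nat \<Rightarrow> array \<Rightarrow> labeling" where
  "Psi k h =
    (\<lambda>i j. if 1 \<le> i \<and> i \<le> j \<and> j \<le> k - 1
       then h i j + h (i - 1) j - h (i - 1) (j - 1) - h i (j + 1) else 0,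
     \<lambda>i j. if 1 \<le> i \<and> i \<le> j \<and> j \<le> k - 1
       then h (i - 1) j + h i (j + 1) - h i j - h (i - 1) (j + 1) else 0,
     \<lambda>i j. if 1 \<le> i \<and> i \<le> j \<and> j \<le> k - 1
       then h i j + h i (j + 1) - h (i - 1) j - h (i + 1) (j + 1) else 0)"

end

theory Submission
  imports Defs "HOL-Library.FuncSet"
begin

text \<open>
  The \<open>y\<close>-coordinates of the image of \<open>A\<close> are the strictly upper entries \<open>a\<^sub>i\<^sub>j\<close>, \<open>1 \<le> i < j\<close>. Prescribing in
  addition the row \<open>\<mu>\<close> and the column sums \<open>\<lambda>\<close> fixes the diagonal, hence all of \<open>A\<close>. Conversely, if
  \<open>\<lambda>\<close> and \<open>\<mu>\<close> have the consecutive differences dictated by a labeling in \<open>W\<close>, the array rebuilt from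
  \<open>\<lambda>\<close>, \<open>\<mu>\<close> and \<open>y\<close> is sent back to that labeling: the \<open>x\<close>-coordinates agree by induction on \<open>i\<close> using
  (BZ2), and the \<open>z\<close>-coordinates by induction on \<open>j\<close> using (BZ1). The cone inequalities (P), (CS), (LR)
  are literally the nonnegativity of \<open>y\<close>, \<open>x\<close>, \<open>z\<close>. The row sums of the rebuilt array have the same
  consecutive differences as \<open>\<nu>\<close>, so they equal \<open>\<nu>\<close> exactly when the totals match.
\<close>

definition cs_slack :: "array \<Rightarrow> nat \<Rightarrow> nat \<Rightarrow> real" where
  "cs_slack A i j = (\<Sum>p<i. A p j) - (\<Sum>p\<le>i. A p (j + 1))"

definition lr_slack :: "array \<Rightarrow> nat \<Rightarrow> nat \<Rightarrow> real" where
  "lr_slack A i j = (\<Sum>q=i..j. A i q) - (\<Sum>q=i+1..j+1. A (i + 1) q)"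

text \<open>Each of the rows \<open>0\<close> to \<open>i\<close> gains exactly one entry when the
  column bound moves up. The hypotheses keep both index pairs inside the range where
  \<open>Phi\<close> is not cut off to zero.\<close>

lemma Phi_diff_column:
  assumes "i \<le> j" "j < k"
  shows "Phi k A i (Suc j) - Phi k A i j = (\<Sum>p\<le>i. A p (Suc j))"
proof -
  have "(\<Sum>p\<le>i. \<Sum>q=p..Suc j. A p q) = (\<Sum>p\<le>i. (\<Sum>q=p..j. A p q) + A p (Suc j))"
    using assms by (intro sum.cong) (auto simp: sum.nat_ivl_Suc')
  then show ?thesis
    using assms by (simp add: Phi_def sum.distrib)
qed

lemma Phi_diff_row:
  assumes "Suc i \<le> j" "j \<le> k"
  shows "Phi k A (Suc i) j - Phi k A i j = (\<Sum>q=Suc i..j. A (Suc i) q)"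
  using assms by (simp add: Phi_def)

text \<open>Each of the three four-term combinations regroups into two differences of adjacent
  entries of \<open>Phi k A\<close>, that is, into partial column sums for \<open>x\<close> and
  \<open>y\<close> and row sums for \<open>z\<close>.\<close>

lemma Psi_Phi:
  "Psi k (Phi k A) =
    (\<lambda>i j. if 1 \<le> i \<and> i \<le> j \<and> j \<le> k - 1 then cs_slack A i j else 0,
     \<lambda>i j. if 1 \<le> i \<and> i \<le> j \<and> j \<le> k - 1 then A i (j + 1) else 0,
     \<lambda>i j. if 1 \<le> i \<and> i \<le> j \<and> j \<le> k - 1 then lr_slack A i j else 0)"
proof -
  let ?h = "Phi k A"
  have *: "?h i j + ?h (i - 1) j - ?h (i - 1) (j - 1) - ?h i (j + 1) = cs_slack A i j
      \<and> ?h (i - 1) j + ?h i (j + 1) - ?h i j - ?h (i - 1) (j + 1) = A i (j + 1)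
      \<and> ?h i j + ?h i (j + 1) - ?h (i - 1) j - ?h (i + 1) (j + 1) = lr_slack A i j"
    if ij: "1 \<le> i \<and> i \<le> j \<and> j \<le> k - 1" for i j
  proof -
    obtain i' j' where [simp]: "i = Suc i'" "j = Suc j'"
      using ij by (metis Suc_le_D One_nat_def le_trans)
    have jk: "j < k" using ij by auto
    have c1: "?h i (Suc j) - ?h i j = (\<Sum>p\<le>i. A p (Suc j))"
      and c2: "?h i' (Suc j) - ?h i' j = (\<Sum>p\<le>i'. A p (Suc j))"
      and c3: "?h i' j - ?h i' j' = (\<Sum>p\<le>i'. A p j)"
      using Phi_diff_column[of i j k A] Phi_diff_column[of i' j k A]
        Phi_diff_column[of i' j' k A] ij jk by auto
    have r1: "?h i j - ?h i' j = (\<Sum>q=i..j. A i q)"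
      and r2: "?h (Suc i) (Suc j) - ?h i (Suc j) = (\<Sum>q=Suc i..Suc j. A (Suc i) q)"
      using Phi_diff_row[of i' j k A] Phi_diff_row[of i "Suc j" k A] ij jk by auto
    show ?thesis
      using c1 c2 c3 r1 r2 by (simp add: cs_slack_def lr_slack_def lessThan_Suc_atMost)
  qed
  show ?thesis
    unfolding Psi_def using * by (simp add: fun_eq_iff)
qed

lemma linear_Psi_Phi: "Vector_Spaces.linear array_scale labeling_scale (Psi k \<circ> Phi k)"
proof -
  have add: "Psi k (Phi k (A + B)) = Psi k (Phi k A) + Psi k (Phi k B)" for A B
    unfolding Psi_Phi by (auto simp: fun_eq_iff cs_slack_def lr_slack_def sum.distrib)
  have scale: "Psi k (Phi k (array_scale c A)) = labeling_scale c (Psi k (Phi k A))" for c A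
    unfolding Psi_Phi
    by (auto simp: fun_eq_iff cs_slack_def lr_slack_def array_scale_def labeling_scale_def
        sum_distrib_left right_diff_distrib simp del: sum.cl_ivl_Suc)
  have "vector_space array_scale" "vector_space labeling_scale"
    by (unfold_locales; auto simp: array_scale_def labeling_scale_def fun_eq_iff algebra_simps)+
  then show ?thesis
    unfolding Vector_Spaces.linear_def module_hom_def module_hom_axioms_def
    by (simp add: add scale vector_space.vector_space_assms module_def)
qed

text \<open>At column \<open>Suc j\<close> this is (BZ2) for the image of \<open>A\<close>;
  \<open>lr_slack_step\<close> is (BZ1), and (BZ3) is a consequence of the two. The same recursions
  drive the inductions in \<open>Psi_Phi_rebuild\<close>.\<close>

lemma cs_slack_step:
  "cs_slack A (Suc i) j = cs_slack A i j + A i j - A (Suc i) (Suc j)"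
  by (simp add: cs_slack_def)

lemma lr_slack_step:
  assumes "i \<le> Suc j"
  shows "lr_slack A i (Suc j) = lr_slack A i j + A i (Suc j) - A (Suc i) (Suc (Suc j))"
  using assms by (simp add: lr_slack_def sum.nat_ivl_Suc')

lemma Psi_Phi_in_W_space: "Psi k (Phi k A) \<in> W_space (k - 1)"
  by (auto simp: Psi_Phi W_space_def V_space_def cs_slack_step lr_slack_step)

lemma LR_cone_iff:
  assumes "A \<in> T_space k"
  shows "A \<in> LR_cone k \<longleftrightarrow> Psi k (Phi k A) \<in> BZ_cone (k - 1)"
proof -
  have P: "(\<forall>i j. 1 \<le> i \<and> i < j \<and> j \<le> k \<longrightarrow> A i j \<ge> 0) \<longleftrightarrow>
      (\<forall>i j. 1 \<le> i \<and> i \<le> j \<and> j \<le> k - 1 \<longrightarrow> A i (j + 1) \<ge> 0)" (is "?L \<longleftrightarrow> ?R")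
  proof
    assume ?R
    show ?L
    proof (intro allI impI)
      fix i j assume ij: "1 \<le> i \<and> i < j \<and> j \<le> k"
      then have "1 \<le> i \<and> i \<le> j - 1 \<and> j - 1 \<le> k - 1" by linarith
      then have "A i ((j - 1) + 1) \<ge> 0" using \<open>?R\<close> by blast
      then show "A i j \<ge> 0" using ij by simp
    qed
  qed auto
  have lt: "1 \<le> i \<and> i \<le> j \<and> j < k \<longleftrightarrow> 1 \<le> i \<and> i \<le> j \<and> j \<le> k - 1" for i j
    by auto
  have "A \<in> LR_cone k \<longleftrightarrow> (\<forall>i j. 1 \<le> i \<and> i \<le> j \<and> j \<le> k - 1 \<longrightarrow>
      cs_slack A i j \<ge> 0 \<and> A i (j + 1) \<ge> 0 \<and> lr_slack A i j \<ge> 0)"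
    unfolding LR_cone_def mem_Collect_eq P lt cs_slack_def lr_slack_def using assms by auto
  also have "\<dots> \<longleftrightarrow> Psi k (Phi k A) \<in> BZ_cone (k - 1)"
    using Psi_Phi_in_W_space[of k A] by (auto simp: BZ_cone_def Psi_Phi)
  finally show ?thesis .
qed

text \<open>The shift to \<open>j - 1\<close> undoes \<open>y i j = A i (j + 1)\<close>. The
  diagonal entry is what column \<open>j\<close> still lacks of \<open>lam j\<close>, and the guard
  \<open>1 \<le> j\<close> makes the corner vanish.\<close>

definition rebuild :: "nat \<Rightarrow> (nat \<Rightarrow> real) \<Rightarrow> (nat \<Rightarrow> real) \<Rightarrow> array \<Rightarrow> array" where
  "rebuild k lam mu y = (\<lambda>i j. if i \<le> j \<and> 1 \<le> j \<and> j \<le> k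
     then if i = 0 then mu j
       else if i < j then y i (j - 1)
       else lam j - mu j - (\<Sum>p=1..<j. y p (j - 1))
     else 0)"

lemma rebuild_in_T_space: "rebuild k lam mu y \<in> T_space k"
  by (auto simp: rebuild_def T_space_def)

lemma sum_atMost_split_ends:
  fixes f :: "nat \<Rightarrow> real"
  assumes "1 \<le> j"
  shows "(\<Sum>p\<le>j. f p) = f 0 + (\<Sum>p=1..<j. f p) + f j"
proof -
  have "{..j} = insert 0 (insert j {1..<j})" using assms by auto
  then show ?thesis using assms by simp
qed

lemma rebuild_column_sum:
  assumes "1 \<le> j" "j \<le> k"
  shows "(\<Sum>p\<le>j. rebuild k lam mu y p j) = lam j"
proof -
  have "(\<Sum>p=1..<j. rebuild k lam mu y p j) = (\<Sum>p=1..<j. y p (j - 1))"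
    using assms by (intro sum.cong) (auto simp: rebuild_def)
  then show ?thesis
    using assms unfolding sum_atMost_split_ends[OF assms(1)] by (simp add: rebuild_def)
qed

lemma rebuild_self:
  assumes T: "A \<in> T_space k"
    and mu: "\<forall>j\<in>{1..k}. mu j = A 0 j"
    and lam: "\<forall>j\<in>{1..k}. lam j = (\<Sum>p\<le>j. A p j)"
    and y: "\<And>i j. 1 \<le> i \<Longrightarrow> i < j \<Longrightarrow> j \<le> k \<Longrightarrow> y i (j - 1) = A i j"
  shows "rebuild k lam mu y = A"
proof (intro ext)
  fix i j
  have diag: "lam j - mu j - (\<Sum>p=1..<j. y p (j - 1)) = A j j" if j: "1 \<le> j" "j \<le> k"
  proof -
    have "(\<Sum>p=1..<j. y p (j - 1)) = (\<Sum>p=1..<j. A p j)"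
      using y j by (intro sum.cong) auto
    then show ?thesis
      using lam mu j sum_atMost_split_ends[of j "\<lambda>p. A p j"] by auto
  qed
  show "rebuild k lam mu y i j = A i j"
  proof (cases "i \<le> j \<and> 1 \<le> j \<and> j \<le> k")
    case True
    then show ?thesis
      using diag mu y[of i j] by (cases "i = j") (auto simp: rebuild_def)
  next
    case False
    then have "A i j = 0"
      \<comment> \<open>The corner lies in the triangle but outside the guard of
        \<open>rebuild\<close>; it vanishes by the normalisation in \<open>T_space\<close>.\<close>
      using T by (cases "i = 0 \<and> j = 0") (auto simp: T_space_def not_less_eq_eq)
    then show ?thesis using False by (auto simp: rebuild_def)
  qed
qed

lemma Psi_Phi_rebuild:
  assumes W: "(x, y, z) \<in> W_space (k - 1)"
    and mu: "\<forall>j\<in>{1..k-1}. x 1 j + y 1 j = mu j - mu (j + 1)"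
    and lam: "\<forall>j\<in>{1..k-1}. x j j + z j j = lam j - lam (j + 1)"
  shows "Psi k (Phi k (rebuild k lam mu y)) = (x, y, z)"
proof -
  let ?A = "rebuild k lam mu y"
  have upper: "?A i (Suc j) = y i j" if "1 \<le> i" "i \<le> j" "j \<le> k - 1" for i j
  proof -
    have "Suc j \<le> k" using that by linarith
    then show ?thesis using that by (simp add: rebuild_def)
  qed
  have BZ1: "y i j + z i j = y (Suc i) (Suc j) + z i (Suc j)"
    and BZ2: "x i (Suc j) + y i j = x (Suc i) (Suc j) + y (Suc i) (Suc j)"
    if "1 \<le> i" "i \<le> j" "j < k - 1" for i j
    using W that by (auto simp: W_space_def)
  have cs: "1 \<le> i \<Longrightarrow> i \<le> j \<Longrightarrow> j \<le> k - 1 \<Longrightarrow> cs_slack ?A i j = x i j" for i j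
  proof (induction i rule: nat_induct_at_least)
    case base
    have "x 1 j + y 1 j = mu j - mu (j + 1)" using mu base by auto
    moreover have "?A 0 j = mu j" "?A 0 (Suc j) = mu (Suc j)"
      using base by (auto simp: rebuild_def)
    ultimately show ?case
      using base upper[of 1 j] by (simp add: cs_slack_def)
  next
    case (Suc i)
    \<comment> \<open>(BZ2) relates column \<open>j\<close> to column \<open>j - 1\<close>, which is
      still at least \<open>i\<close> because \<open>Suc i \<le> j\<close>.\<close>
    obtain j' where [simp]: "j = Suc j'" using Suc.prems by (cases j) auto
    show ?case
      using Suc upper[of i j'] upper[of "Suc i" j] BZ2[of i j'] by (simp add: cs_slack_step)
  qed
  have lr: "i \<le> j \<Longrightarrow> 1 \<le> i \<Longrightarrow> j \<le> k - 1 \<Longrightarrow> lr_slack ?A i j = z i j" for i j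
  proof (induction j rule: nat_induct_at_least)
    case base
    \<comment> \<open>On the diagonal both sums in \<open>lr_slack\<close> are single entries,
      precisely those missing from the partial columns in \<open>cs_slack\<close>.\<close>
    have "lr_slack ?A i i + cs_slack ?A i i
        = (\<Sum>p\<le>i. ?A p i) - (\<Sum>p\<le>Suc i. ?A p (Suc i))"
      by (simp add: lr_slack_def cs_slack_def flip: lessThan_Suc_atMost)
    also have "\<dots> = lam i - lam (Suc i)"
      using base rebuild_column_sum[of i k lam mu y] rebuild_column_sum[of "Suc i" k lam mu y]
      by simp
    finally show ?case
      using cs[of i i] lam[rule_format, of i] base by auto
  next
    case (Suc j)
    then show ?case
      using upper[of i j] upper[of "Suc i" "Suc j"] BZ1[of i j] by (simp add: lr_slack_step)
  qed
  show ?thesis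
    using W cs lr upper unfolding Psi_Phi
    by (auto simp: fun_eq_iff W_space_def V_space_def)
qed

lemma BZ_cone_subset_image:
  assumes "X \<in> BZ_cone (k - 1)"
  shows "X \<in> (Psi k \<circ> Phi k) ` LR_cone k"
proof -
  obtain x y z where X: "X = (x, y, z)" by (metis prod_cases3)
  \<comment> \<open>No type is prescribed here, so tail sums serve: their consecutive differences
    are the required ones, normalised by \<open>mu k = lam k = 0\<close>.\<close>
  define mu where "mu j = (\<Sum>q=j..<k. x 1 q + y 1 q)" for j
  define lam where "lam j = (\<Sum>q=j..<k. x q q + z q q)" for j
  have W: "(x, y, z) \<in> W_space (k - 1)" using assms X by (auto simp: BZ_cone_def)
  have "Psi k (Phi k (rebuild k lam mu y)) = X"
    unfolding X by (rule Psi_Phi_rebuild[OF W])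
      (auto simp: mu_def lam_def sum.atLeast_Suc_lessThan)
  moreover from this have "rebuild k lam mu y \<in> LR_cone k"
    using LR_cone_iff[OF rebuild_in_T_space] assms by metis
  ultimately show ?thesis by (metis comp_apply imageI)
qed

text \<open>The difference \<open>f - g\<close> is constant on \<open>{1..k}\<close>, and equal
  totals make \<open>k\<close> times that constant zero.\<close>

lemma equal_differences_equal_sum_imp_equal:
  fixes f g :: "nat \<Rightarrow> real"
  assumes diff: "\<And>i. 1 \<le> i \<Longrightarrow> i < k \<Longrightarrow> f i - f (Suc i) = g i - g (Suc i)"
    and total: "(\<Sum>i=1..k. f i) = (\<Sum>i=1..k. g i)"
    and i: "1 \<le> i" "i \<le> k"
  shows "f i = g i"
proof -
  have const: "1 \<le> i \<Longrightarrow> i \<le> k \<Longrightarrow> f i - g i = f 1 - g 1" for i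
  proof (induction i rule: nat_induct_at_least)
    case (Suc i)
    then show ?case using diff[of i] by simp
  qed simp
  have "0 = (\<Sum>i=1..k. f i - g i)" using total by (simp add: sum_subtractf)
  also have "\<dots> = (\<Sum>i=1..k. f 1 - g 1)" by (intro sum.cong refl const) auto
  finally have "f 1 = g 1" using i by simp
  then show ?thesis using const[OF i] by simp
qed

text \<open>Row \<open>0\<close> is split off and the order of summation over the remaining triangle
  is swapped. For a triangle of type \<open>(lam, mu, nu)\<close> this is |lam| = |mu| +
  |nu|.\<close>

lemma total_by_rows_and_columns:
  fixes A :: array
  shows "(\<Sum>j=1..k. \<Sum>p\<le>j. A p j) = (\<Sum>j=1..k. A 0 j) + (\<Sum>i=1..k. \<Sum>q=i..k. A i q)"
proof -
  have "(\<Sum>p\<le>j. A p j) = A 0 j + (\<Sum>p=1..j. A p j)" for j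
    by (simp add: atMost_atLeast0 sum.atLeast_Suc_atMost)
  moreover have "(\<Sum>j=1..k. \<Sum>p=1..j. A p j) = (\<Sum>i=1..k. \<Sum>q=i..k. A i q)"
    unfolding sum.Sigma[OF finite_atLeastAtMost ballI[OF finite_atLeastAtMost]]
    by (rule sum.reindex_bij_witness[where i = prod.swap and j = prod.swap]) auto
  ultimately show ?thesis by (simp add: sum.distrib)
qed

text \<open>In the last slack, row \<open>i + 1\<close> is already complete while row
  \<open>i\<close> stops one column short; \<open>A i k\<close> completes it. The left side is
  \<open>y + z\<close> of the image at \<open>(i, k - 1)\<close>.\<close>

lemma row_sum_diff:
  assumes "1 \<le> i" "i < k"
  shows "A i k + lr_slack A i (k - 1) = (\<Sum>q=i..k. A i q) - (\<Sum>q=Suc i..k. A (Suc i) q)"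
  using assms by (cases k) (auto simp: lr_slack_def sum.nat_ivl_Suc')

lemma LR_of_type_maps_to_BZ_of_type:
  assumes "A \<in> LR_of_type k lam mu nu"
  shows "Psi k (Phi k A) \<in> BZ_of_type (k - 1) lam mu nu"
proof -
  have A: "A \<in> LR_cone k" "A \<in> T_space k"
    and mu: "\<And>j. 1 \<le> j \<Longrightarrow> j \<le> k \<Longrightarrow> mu j = A 0 j"
    and lam: "\<And>j. 1 \<le> j \<Longrightarrow> j \<le> k \<Longrightarrow> lam j = (\<Sum>p\<le>j. A p j)"
    and nu: "\<And>i. 1 \<le> i \<Longrightarrow> i \<le> k \<Longrightarrow> nu i = (\<Sum>q=i..k. A i q)"
    using assms by (auto simp: LR_of_type_def LR_cone_def)
  have BZ: "Psi k (Phi k A) \<in> BZ_cone (k - 1)"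
    using A LR_cone_iff by blast
  have "cs_slack A 1 j + A 1 (Suc j) = mu j - mu (Suc j)" if "1 \<le> j" "j \<le> k - 1" for j
    using that by (simp add: mu cs_slack_def)
  moreover have "cs_slack A j j + lr_slack A j j = lam j - lam (Suc j)"
    if "1 \<le> j" "j \<le> k - 1" for j
    using that by (simp add: lam cs_slack_def lr_slack_def flip: lessThan_Suc_atMost)
  moreover have "A i k + lr_slack A i (k - 1) = nu i - nu (Suc i)"
    if "1 \<le> i" "i \<le> k - 1" for i
    using that row_sum_diff[of i k A] by (simp add: nu)
  ultimately show ?thesis
    using BZ unfolding BZ_of_type_def Psi_Phi by auto
qed

lemma bij_betw_LR_BZ_of_type:
  assumes total: "(\<Sum>j=1..k. lam j) = (\<Sum>j=1..k. mu j) + (\<Sum>j=1..k. nu j)"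
  shows "bij_betw (Psi k \<circ> Phi k) (LR_of_type k lam mu nu) (BZ_of_type (k - 1) lam mu nu)"
\<comment> \<open>The inverse reads only the \<open>y\<close>-coordinates of \<open>X\<close>; the
  type supplies the rest.\<close>
proof (rule bij_betwI[where g = "\<lambda>X. rebuild k lam mu (fst (snd X))"])
  show "Psi k \<circ> Phi k \<in> LR_of_type k lam mu nu \<rightarrow> BZ_of_type (k - 1) lam mu nu"
    using LR_of_type_maps_to_BZ_of_type by auto
next
  fix A assume "A \<in> LR_of_type k lam mu nu"
  then show "rebuild k lam mu (fst (snd ((Psi k \<circ> Phi k) A))) = A"
    by (intro rebuild_self) (auto simp: LR_of_type_def LR_cone_def Psi_Phi)
next
  fix X assume "X \<in> BZ_of_type (k - 1) lam mu nu"
  then show "(Psi k \<circ> Phi k) (rebuild k lam mu (fst (snd X))) = X"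
    using Psi_Phi_rebuild by (auto simp: BZ_of_type_def BZ_cone_def)
next
  show "(\<lambda>X. rebuild k lam mu (fst (snd X))) \<in> BZ_of_type (k - 1) lam mu nu \<rightarrow> LR_of_type k lam mu nu"
  proof
    fix X assume X: "X \<in> BZ_of_type (k - 1) lam mu nu"
    obtain x y z where xyz: "X = (x, y, z)" by (metis prod_cases3)
    let ?A = "rebuild k lam mu y"
    have img: "Psi k (Phi k ?A) = (x, y, z)"
      using X xyz by (intro Psi_Phi_rebuild) (auto simp: BZ_of_type_def BZ_cone_def)
    have LR: "?A \<in> LR_cone k"
      using X xyz img LR_cone_iff[OF rebuild_in_T_space] by (auto simp: BZ_of_type_def)
    have mu: "mu j = ?A 0 j" and lam: "lam j = (\<Sum>p\<le>j. ?A p j)" if "j \<in> {1..k}" for j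
      using that rebuild_column_sum[of j k lam mu y] by (auto simp: rebuild_def)
    have "nu i = (\<Sum>q=i..k. ?A i q)" if "1 \<le> i" "i \<le> k" for i
    proof (rule equal_differences_equal_sum_imp_equal[OF _ _ that])
      fix i assume i: "1 \<le> i" "i < k"
      have "y i (k - 1) = ?A i k"
        using i by (simp add: rebuild_def)
      moreover have "z i (k - 1) = lr_slack ?A i (k - 1)"
      proof -
        have "z = snd (snd (Psi k (Phi k ?A)))" using img by simp
        moreover have "i \<le> k - 1" using i by linarith
        ultimately show ?thesis using i by (simp add: Psi_Phi)
      qed
      moreover have "y i (k - 1) + z i (k - 1) = nu i - nu (Suc i)"
        using X xyz i by (auto simp: BZ_of_type_def)
      ultimately show "nu i - nu (Suc i) = (\<Sum>q=i..k. ?A i q) - (\<Sum>q=Suc i..k. ?A (Suc i) q)"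
        using row_sum_diff[OF i, of ?A] by simp
    next
      \<comment> \<open>The columns already realise \<open>lam\<close> and row \<open>0\<close>
        realises \<open>mu\<close>, so the total of the other rows is |lam| - |mu| = |nu|.\<close>
      have "(\<Sum>j=1..k. lam j) = (\<Sum>j=1..k. \<Sum>p\<le>j. ?A p j)"
        by (rule sum.cong[OF refl lam])
      moreover have "(\<Sum>j=1..k. mu j) = (\<Sum>j=1..k. ?A 0 j)"
        by (rule sum.cong[OF refl mu])
      ultimately show "(\<Sum>i=1..k. nu i) = (\<Sum>i=1..k. \<Sum>q=i..k. ?A i q)"
        using total total_by_rows_and_columns[of ?A k] by linarith
    qed
    then show "rebuild k lam mu (fst (snd X)) \<in> LR_of_type k lam mu nu"
      using LR mu lam xyz by (auto simp: LR_of_type_def)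
  qed
qed

theorem theorem5p2:
  fixes k :: nat
  assumes "k \<ge> 2"
  shows "Vector_Spaces.linear array_scale labeling_scale (Psi k \<circ> Phi k) \<and>
    (Psi k \<circ> Phi k) ` T_space k \<subseteq> W_space (k - 1) \<and>
    (Psi k \<circ> Phi k) ` LR_cone k = BZ_cone (k - 1) \<and>
    (\<forall>lam \<in> D_tuples k. \<forall>mu \<in> D_tuples k. \<forall>nu \<in> D_tuples k.
      (\<Sum>j=1..k. lam j) = (\<Sum>j=1..k. mu j) + (\<Sum>j=1..k. nu j) \<longrightarrow>
      bij_betw (Psi k \<circ> Phi k) (LR_of_type k lam mu nu) (BZ_of_type (k - 1) lam mu nu))"
proof (intro conjI ballI impI)
  show "(Psi k \<circ> Phi k) ` LR_cone k = BZ_cone (k - 1)"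
  proof (intro equalityI subsetI)
    fix X assume "X \<in> (Psi k \<circ> Phi k) ` LR_cone k"
    then show "X \<in> BZ_cone (k - 1)"
      using LR_cone_iff by (auto simp: LR_cone_def)
  qed (rule BZ_cone_subset_image)
next
  show "(Psi k \<circ> Phi k) ` T_space k \<subseteq> W_space (k - 1)"
    using Psi_Phi_in_W_space by (auto simp del: One_nat_def)
next
  fix lam mu nu :: "nat \<Rightarrow> real"
  assume "(\<Sum>j=1..k. lam j) = (\<Sum>j=1..k. mu j) + (\<Sum>j=1..k. nu j)"
  then show "bij_betw (Psi k \<circ> Phi k) (LR_of_type k lam mu nu) (BZ_of_type (k - 1) lam mu nu)"
    by (rule bij_betw_LR_BZ_of_type)
qed (rule linear_Psi_Phi)

end
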